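(* Let $p\geq 5$ be a prime number. Then the clique number of the weakly nil clean graph $G_{WN}(\mathbb{Z}_{2p})$ is $4$.
   Context: $\mathbb{Z}_{2p}$ is the ring of integers modulo $2p$. For a ring $R$, $Idem(R)$ is the set of idempotents and $Nil(R)$ the set of nilpotent elements of $R$. An element $x\in R$ is weakly nil clean if $x=n+e$ or $x=n-e$ for some $e\in Idem(R)$ and $n\in Nil(R)$. The weakly nil clean graph $G_{WN}(R)$ is the simple undirected graph (no loops) with vertex set $R$, in which two distinct vertices $x,y$ are adjacent if and only if $x+y$ is a weakly nil clean element of $R$. The clique number of a graph is the number of vertices in a maximum clique, i.e. a largest set of pairwise adjacent vertices. *)

theory Defs
  imports "HOL-Number_Theory.Residues" "HOL-Library.Ramsey"
begin

definition idempotents :: "('a, 'm) ring_scheme \<Rightarrow> 'a set" where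
  "idempotents R = {e \<in> carrier R. e \<otimes>\<^bsub>R\<^esub> e = e}"

definition nilpotents :: "('a, 'm) ring_scheme \<Rightarrow> 'a set" where
  "nilpotents R = {x \<in> carrier R. \<exists>k::nat. k > 0 \<and> x [^]\<^bsub>R\<^esub> k = \<zero>\<^bsub>R\<^esub>}"

definition weakly_nil_clean :: "('a, 'm) ring_scheme \<Rightarrow> 'a \<Rightarrow> bool" where
  "weakly_nil_clean R x \<longleftrightarrow>
     x \<in> carrier R \<and>
     (\<exists>e \<in> idempotents R. \<exists>n \<in> nilpotents R. x = n \<oplus>\<^bsub>R\<^esub> e \<or> x = n \<ominus>\<^bsub>R\<^esub> e)"

text \<open>
  A simple undirected graph is a pair of a vertex set and a set of two-element
  subsets of it, the edges, as in the predicate \<^const>\<open>clique\<close>.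
\<close>

definition G_WN :: "('a, 'm) ring_scheme \<Rightarrow> 'a set \<times> 'a set set" where
  "G_WN R =
     (carrier R,
      {{x, y} | x y. x \<in> carrier R \<and> y \<in> carrier R \<and> x \<noteq> y \<and>
                     weakly_nil_clean R (x \<oplus>\<^bsub>R\<^esub> y)})"

text \<open>
  Meaningful for graphs with finitely many vertices only, since \<^const>\<open>Max\<close> is
  unspecified on infinite sets and infinite cliques have \<^const>\<open>card\<close> zero.
  The predicate \<^const>\<open>clique\<close> does not require its first argument to consist of
  vertices, so this is demanded separately.
\<close>

definition clique_number :: "'a set \<times> 'a set set \<Rightarrow> nat" where
  "clique_number G = Max {card C | C. C \<subseteq> fst G \<and> clique C (snd G)}"

end

theory Submission
  imports Defs
begin

text \<open>
  For an odd prime \<open>p\<close> the ring \<open>\<int>/2p\<close> is the product of \<open>\<int>/2\<close> and the field \<open>\<int>/p\<close>.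
  Both factors are reduced, and every element of \<open>\<int>/2\<close> is idempotent, so an element is weakly
  nil clean exactly if its residue modulo \<open>p\<close> is \<open>-1\<close>, \<open>0\<close> or \<open>1\<close>
  (\<open>weakly_nil_clean_iff\<close>). Adjacency of \<open>x\<close> and \<open>y\<close> therefore depends only on
  \<open>x + y\<close> modulo \<open>p\<close>, and each class modulo \<open>p\<close> contains two vertices.

  Consider three pairwise incongruent members of a clique. Their three pairwise sums are
  incongruent as well, so these sums are \<open>-1\<close>, \<open>0\<close>, \<open>1\<close> in some order. Their total is
  \<open>0\<close>, and since \<open>2\<close> is invertible this determines the members: they are again
  \<open>-1\<close>, \<open>0\<close>, \<open>1\<close> (\<open>pairwise_ternary_sums_imp_ternary_residue\<close>). Hence a clique either
  meets at most two classes, and has at most \<open>2 + 2\<close> elements, or lies in the classes of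
  \<open>-1\<close>, \<open>0\<close> and \<open>1\<close>. In the latter case the classes of \<open>\<plusminus>1\<close> contribute at most
  one element each, because two congruent elements there have sum \<open>\<plusminus>2\<close>, which is none of \<open>-1\<close>, \<open>0\<close>,
  \<open>1\<close> when \<open>p \<ge> 5\<close>; so the bound is \<open>2 + 1 + 1\<close>. This second pattern is attained by
  \<open>{0, 1, p, 2p - 1}\<close>.
\<close>

text \<open>The residues \<open>0\<close>, \<open>1\<close>, \<open>-1\<close> are the idempotents of the field and their negatives.\<close>

definition ternary_residue :: "int \<Rightarrow> int \<Rightarrow> bool" where
  "ternary_residue p x \<longleftrightarrow> p dvd x \<or> p dvd x - 1 \<or> p dvd x + 1"

lemma idempotent_residue_iff:
  assumes "m > 1"
  shows "e \<in> idempotents (residue_ring m) \<longleftrightarrow> 0 \<le> e \<and> e < m \<and> m dvd e * (e - 1)"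
proof -
  have "e * e mod m = e \<longleftrightarrow> m dvd e * (e - 1)" if "0 \<le> e" "e < m"
    using that by (metis mod_eq_dvd_iff mod_pos_pos_trivial mult.right_neutral right_diff_distrib)
  then show ?thesis
    by (auto simp: idempotents_def residue_ring_def)
qed

lemma nilpotent_residue_dvd:
  assumes "m > 1" "prime p" "p dvd m" "n \<in> nilpotents (residue_ring m)"
  shows "p dvd n"
proof -
  interpret residues m "residue_ring m"
    by unfold_locales (use assms in auto)
  from assms obtain k where n: "0 \<le> n" "n < m" and k: "n [^]\<^bsub>residue_ring m\<^esub> (k::nat) = 0"
    by (auto simp: nilpotents_def res_carrier_eq res_zero_eq)
  have "n ^ k mod m = 0"
    using pow_cong[of n k] k n by simp
  then have "p dvd n ^ k"
    using assms(3) by (meson dvd_trans mod_eq_0_iff_dvd)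
  then show ?thesis
    using assms(2) prime_dvd_power by blast
qed

text \<open>
  From left to right, the nilpotent part vanishes in the field \<open>\<int>/p\<close>, whose idempotents are
  \<open>0\<close> and \<open>1\<close>. From right to left, \<open>0\<close> serves as the nilpotent part: if \<open>x\<close> is \<open>0\<close> or \<open>1\<close>
  modulo \<open>p\<close> then \<open>x\<close> is idempotent, as \<open>x(x - 1)\<close> is even anyway, and if \<open>x\<close> is \<open>-1\<close>
  modulo \<open>p\<close> then the same applies to \<open>-x\<close>.
\<close>

lemma weakly_nil_clean_iff:
  fixes p :: int
  assumes p: "prime p" "odd p"
  shows "weakly_nil_clean (residue_ring (2 * p)) x \<longleftrightarrow>
           0 \<le> x \<and> x < 2 * p \<and> ternary_residue p x"
    (is "?L \<longleftrightarrow> ?R")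
proof -
  let ?Z = "residue_ring (2 * p)"
  have m: "2 * p > 1"
    using prime_gt_1_int[OF p(1)] by simp
  interpret residues "2 * p" ?Z
    by unfold_locales (use m in auto)
  have sub: "a \<ominus>\<^bsub>?Z\<^esub> b = (a - b) mod (2 * p)" for a b
    by (simp add: a_minus_def res_neg_eq res_add_eq mod_add_right_eq)
  have dvd_mod: "p dvd y mod (2 * p) - c \<longleftrightarrow> p dvd y - c" for y c
    by (simp add: mod_eq_dvd_iff[symmetric] mod_mod_cancel)
  have idem: "y mod (2 * p) \<in> idempotents ?Z" if "p dvd y * (y - 1)" for y
  proof -
    have "2 * p dvd y * (y - 1)"
      using that p(2) by (intro divides_mult) auto
    moreover have "[y mod (2 * p) * (y mod (2 * p) - 1) = y * (y - 1)] (mod (2 * p))"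
      by (intro cong_mult cong_diff) (auto simp: cong_def)
    ultimately have "2 * p dvd y mod (2 * p) * (y mod (2 * p) - 1)"
      by (simp add: cong_dvd_iff)
    then show ?thesis
      using m by (simp add: idempotent_residue_iff)
  qed
  have zero: "0 \<in> nilpotents ?Z"
    using m pow_cong[of 0 1] by (auto simp: nilpotents_def res_carrier_eq res_zero_eq intro!: exI[of _ 1])
  show ?thesis
  proof
    assume ?L
    then obtain e n where x: "0 \<le> x" "x < 2 * p"
      and e: "e \<in> idempotents ?Z" and n: "n \<in> nilpotents ?Z"
      and xne: "x = (n + e) mod (2 * p) \<or> x = (n - e) mod (2 * p)"
      by (auto simp: weakly_nil_clean_def res_carrier_eq res_add_eq sub)
    have "p dvd n"
      using nilpotent_residue_dvd[OF m p(1) _ n] by simp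
    have "p dvd e * (e - 1)"
      using e m by (meson dvd_trans dvd_triv_right idempotent_residue_iff)
    then have "p dvd e \<or> p dvd e - 1"
      using p(1) prime_dvd_mult_iff by blast
    moreover have "p dvd x - e \<or> p dvd x + e"
      using xne dvd_mod[of "n + e" e] dvd_mod[of "n - e" "- e"] \<open>p dvd n\<close> by auto
    ultimately consider "p dvd (x - e) + e" | "p dvd (x - e) + (e - 1)"
        | "p dvd (x + e) - e" | "p dvd (x + e) - (e - 1)"
      using dvd_add dvd_diff by blast
    then have "ternary_residue p x"
      by cases (simp_all add: ternary_residue_def)
    with x show ?R by simp
  next
    assume x: ?R
    then consider "p dvd x * (x - 1)" | "p dvd x * (x + 1)"
      by (auto simp: ternary_residue_def)
    then show ?L
    proof cases
      case 1
      have "x \<in> idempotents ?Z" "x = 0 \<oplus>\<^bsub>?Z\<^esub> x"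
        using idem[OF 1] x by (simp_all add: res_add_eq)
      with x zero show ?thesis
        unfolding weakly_nil_clean_def res_carrier_eq by fastforce
    next
      case 2
      then have neg: "p dvd (- x) * (- x - 1)"
        by (simp add: algebra_simps)
      have "x = 0 \<ominus>\<^bsub>?Z\<^esub> ((- x) mod (2 * p))"
        using x by (simp add: sub mod_minus_eq)
      with idem[OF neg] x zero show ?thesis
        unfolding weakly_nil_clean_def res_carrier_eq by fastforce
    qed
  qed
qed

text \<open>
  The sums are \<open>-1\<close>, \<open>0\<close>, \<open>1\<close> in some order, so if \<open>v\<close> is the residue of \<open>b + c\<close>, then
  the residues of \<open>a + b\<close> and \<open>a + c\<close> add up to \<open>-v\<close>. Thus
  \<open>2a = (a + b) + (a + c) - (b + c)\<close> is \<open>-2v\<close> modulo \<open>p\<close>, and \<open>a\<close> is \<open>-v\<close>.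
\<close>

lemma pairwise_ternary_sums_imp_ternary_residue:
  fixes p :: int
  assumes "odd p"
    and "ternary_residue p (a + b)" "ternary_residue p (a + c)" "ternary_residue p (b + c)"
    and "\<not> p dvd a - b" "\<not> p dvd a - c" "\<not> p dvd b - c"
  shows "ternary_residue p a"
proof -
  have residue: "\<exists>t\<in>{-1, 0, 1}. p dvd x - t" if "ternary_residue p x" for x
    using that by (auto simp: ternary_residue_def)
  obtain t u v where t: "t \<in> {-1, 0, 1}" "p dvd (a + b) - t"
    and u: "u \<in> {-1, 0, 1}" "p dvd (a + c) - u"
    and v: "v \<in> {-1, 0, 1}" "p dvd (b + c) - v"
    using assms(2-4)[THEN residue] by blast
  have "t \<noteq> u" "t \<noteq> v" "u \<noteq> v"
    using dvd_diff[OF t(2) u(2)] dvd_diff[OF t(2) v(2)] dvd_diff[OF u(2) v(2)] assms(5-7)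
    by auto
  then have tuv: "t + u + v = 0"
    using t(1) u(1) v(1) by auto
  have "p dvd ((a + b) - t) + ((a + c) - u) - ((b + c) - v)"
    by (rule dvd_diff[OF dvd_add[OF t(2) u(2)] v(2)])
  also have "((a + b) - t) + ((a + c) - u) - ((b + c) - v) = 2 * (a + v)"
    using tuv by simp
  finally have "p dvd a + v"
    using coprime_dvd_mult_right_iff[of p 2 "a + v"] assms(1) by simp
  then show ?thesis
    using v(1) by (auto simp: ternary_residue_def)
qed

lemma card_residue_fibre_le:
  fixes p :: int
  assumes "p > 0" "C \<subseteq> {0..2 * p - 1}"
  shows "card {x \<in> C. x mod p = r} \<le> 2"
proof -
  have "x = r \<or> x = r + p" if "x \<in> C" "x mod p = r" for x
  proof -
    have x: "0 \<le> x" "x < 2 * p"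
      using that(1) assms(2) by auto
    have "x div p < 2"
      using x(2) assms(1) mult_left_mono[of 2 "x div p" p] pos_mod_sign[of p x] mult_div_mod_eq[of p x]
      by linarith
    moreover have "0 \<le> x div p"
      using x(1) assms(1) by (simp add: pos_imp_zdiv_nonneg_iff)
    ultimately have "x div p = 0 \<or> x div p = 1" by linarith
    then show ?thesis
      using that(2) div_mult_mod_eq[of x p] by auto
  qed
  then have "{x \<in> C. x mod p = r} \<subseteq> {r, r + p}"
    by auto
  then have "card {x \<in> C. x mod p = r} \<le> card {r, r + p}"
    by (intro card_mono) auto
  also have "\<dots> \<le> 2"
    by (simp add: card_insert_if)
  finally show ?thesis .
qed

text \<open>
  The combinatorial core: \<open>C\<close> splits into the fibres \<open>F r\<close> of reduction modulo \<open>p\<close>, indexed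
  by the set \<open>I\<close> of residues that occur. Two fibres give at most \<open>2 + 2\<close>. As soon as a third
  occurs, only the residues \<open>0\<close>, \<open>1\<close> and \<open>p - 1\<close> are possible, and the last two occur
  at most once each.
\<close>

lemma card_ternary_sums_le_4:
  fixes p :: int
  assumes p: "odd p" "p \<ge> 5"
    and C: "C \<subseteq> {0..2 * p - 1}"
    and sums: "\<And>x y. x \<in> C \<Longrightarrow> y \<in> C \<Longrightarrow> x \<noteq> y \<Longrightarrow> ternary_residue p (x + y)"
  shows "card C \<le> 4"
proof -
  define F where "F r = {x \<in> C. x mod p = r}" for r
  define I where "I = (\<lambda>x. x mod p) ` C"
  have fin: "finite C"
    using C finite_subset by blast
  then have finI: "finite I" by (simp add: I_def)
  have F2: "card (F r) \<le> 2" for r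
    unfolding F_def by (rule card_residue_fibre_le) (use p C in auto)
  show ?thesis
  proof (cases "card I \<le> 2")
    case True
    have "C = (\<Union>r\<in>I. F r)"
      by (auto simp: F_def I_def)
    then have "card C \<le> (\<Sum>r\<in>I. card (F r))"
      using card_UN_le[OF finI, of F] by simp
    also have "\<dots> \<le> card I * 2"
      using sum_bounded_above[of I "\<lambda>r. card (F r)" 2] F2 by simp
    finally show ?thesis using True by simp
  next
    case False
    have ternary: "ternary_residue p a" if a: "a \<in> C" for a
    proof -
      \<comment> \<open>At least three residues occur, so \<open>a\<close> has two partners \<open>b\<close>, \<open>c\<close> making a triple of
        pairwise incongruent elements.\<close>
      have "card (I - {a mod p}) \<ge> 2"
        using False a finI by (simp add: I_def)
      then obtain T where "T \<subseteq> I - {a mod p}" "card T = 2"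
        using obtain_subset_with_card_n by metis
      then obtain r s where "r \<in> I - {a mod p}" "s \<in> I - {a mod p}" "r \<noteq> s"
        by (auto simp: card_2_iff)
      then obtain b c where bc: "b \<in> C" "c \<in> C" "a mod p \<noteq> b mod p" "a mod p \<noteq> c mod p"
          "b mod p \<noteq> c mod p"
        by (auto simp: I_def)
      show ?thesis
      proof (rule pairwise_ternary_sums_imp_ternary_residue)
        show "odd p" by (rule p(1))
        show "ternary_residue p (a + b)" "ternary_residue p (a + c)" "ternary_residue p (b + c)"
          using a bc by (auto intro!: sums)
        show "\<not> p dvd a - b" "\<not> p dvd a - c" "\<not> p dvd b - c"
          using bc by (auto simp: mod_eq_dvd_iff)
      qed
    qed
    have F1: "card (F r) \<le> 1" if r: "r = 1 \<or> r = p - 1" for r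
    proof (rule ccontr)
      assume "\<not> card (F r) \<le> 1"
      then obtain x y where xy: "x \<in> F r" "y \<in> F r" "x \<noteq> y"
        using card_le_Suc0_iff_eq[of "F r"] fin by (auto simp: F_def)
      then have "ternary_residue p (x + y)"
        by (intro sums) (auto simp: F_def)
      moreover have "(x + y) mod p = (r + r) mod p"
        using xy by (metis (mono_tags, lifting) F_def mem_Collect_eq mod_add_eq)
      then have "p dvd (x + y) - c \<longleftrightarrow> p dvd (r + r) - c" for c
        by (metis mod_diff_left_eq mod_eq_0_iff_dvd)
      note this[of 0] this[of 1] this[of "-1"]
      ultimately have "p dvd 2 * r \<or> p dvd 2 * r - 1 \<or> p dvd 2 * r + 1"
        by (simp add: ternary_residue_def)
      then have "\<exists>c\<in>{-1, 0, 1}. p dvd 2 * r + c"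
        by auto
      then obtain c where c: "c \<in> {-1, 0, 1}" "p dvd 2 * r + c"
        by blast
      \<comment> \<open>Modulo \<open>p\<close>, \<open>2r\<close> is \<open>2\<close> or \<open>-2\<close>; either way \<open>p\<close> divides one of
        \<open>1\<close>, \<open>2\<close>, \<open>3\<close>, impossible for \<open>p \<ge> 5\<close>.\<close>
      have "p dvd 2 + c \<or> p dvd 2 - c"
        using r
      proof
        assume "r = 1" then show ?thesis using c by simp
      next
        assume "r = p - 1"
        then have "p dvd 2 * p - (2 * r + c)" using c(2) by (intro dvd_diff) auto
        also have "2 * p - (2 * r + c) = 2 - c" using \<open>r = p - 1\<close> by simp
        finally show ?thesis by simp
      qed
      then show False
        using c(1) p(2) by (auto dest!: zdvd_imp_le)
    qed
    have "x \<in> F 0 \<union> F 1 \<union> F (p - 1)" if x: "x \<in> C" for x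
    proof -
      consider "x mod p = 0 mod p" | "x mod p = 1 mod p" | "x mod p = (-1) mod p"
        using ternary[OF x] by (auto simp: ternary_residue_def mod_eq_dvd_iff)
      then show ?thesis
        using p(2) x by cases (auto simp: F_def zmod_minus1)
    qed
    then have "card C \<le> card (F 0 \<union> F 1 \<union> F (p - 1))"
      using fin by (intro card_mono) (auto simp: F_def)
    also have "\<dots> \<le> card (F 0) + card (F 1) + card (F (p - 1))"
      by (meson add_le_mono1 card_Un_le order_trans)
    also have "\<dots> \<le> 2 + 1 + 1"
      by (intro add_mono F1 F2) auto
    finally show ?thesis by simp
  qed
qed

text \<open>
  Edges are unordered pairs, so reading adjacency off \<open>x \<oplus> y\<close> in the given order relies on
  commutativity of addition.
\<close>

lemma clique_G_WN_iff:
  assumes "comm_monoid (add_monoid R)" "C \<subseteq> carrier R"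
  shows "clique C (snd (G_WN R)) \<longleftrightarrow>
           (\<forall>x\<in>C. \<forall>y\<in>C. x \<noteq> y \<longrightarrow> weakly_nil_clean R (x \<oplus>\<^bsub>R\<^esub> y))"
proof -
  interpret comm_monoid "add_monoid R" by fact
  have comm: "x \<oplus>\<^bsub>R\<^esub> y = y \<oplus>\<^bsub>R\<^esub> x" if "x \<in> carrier R" "y \<in> carrier R" for x y
    using m_comm[of x y] that by simp
  have "{x, y} \<in> snd (G_WN R) \<longleftrightarrow> weakly_nil_clean R (x \<oplus>\<^bsub>R\<^esub> y)"
    if "x \<in> carrier R" "y \<in> carrier R" "x \<noteq> y" for x y
    using that comm[of x y] by (auto simp: G_WN_def doubleton_eq_iff)
  then show ?thesis
    using assms(2) by (auto simp: clique_def subset_iff)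
qed

theorem theorem3p8:
  fixes p :: nat
  assumes "prime p" and "p \<ge> 5"
  shows "clique_number (G_WN (residue_ring (2 * int p))) = 4"
proof -
  define P where "P = int p"
  let ?Z = "residue_ring (2 * P)"
  have P: "prime P" "P \<ge> 5"
    using assms by (auto simp: P_def)
  have odd: "odd P"
    using P by (simp add: prime_odd_int)
  interpret residues "2 * P" ?Z
    by unfold_locales (use P in auto)
  have wnc: "weakly_nil_clean ?Z (x \<oplus>\<^bsub>?Z\<^esub> y) \<longleftrightarrow> ternary_residue P (x + y)" for x y
  proof -
    have "P dvd (x + y) mod (2 * P) + c \<longleftrightarrow> P dvd x + y + c" for c
      by (metis dvd_mod_iff dvd_triv_right mod_add_left_eq)
    from this[of 0] this[of 1] this[of "-1"] show ?thesis
      using P by (simp add: weakly_nil_clean_iff[OF P(1) odd] res_add_eq ternary_residue_def)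
  qed
  have clique: "clique C (snd (G_WN ?Z)) \<longleftrightarrow>
      (\<forall>x\<in>C. \<forall>y\<in>C. x \<noteq> y \<longrightarrow> ternary_residue P (x + y))" if "C \<subseteq> {0..2 * P - 1}" for C
    using clique_G_WN_iff[of ?Z C] a_comm_monoid that by (simp add: wnc res_carrier_eq)
  have "Max {card C | C. C \<subseteq> {0..2 * P - 1} \<and> clique C (snd (G_WN ?Z))} = 4"
  proof (rule Max_eqI)
    have "{card C | C. C \<subseteq> {0..2 * P - 1} \<and> clique C (snd (G_WN ?Z))}
            \<subseteq> card ` Pow {0..2 * P - 1}"
      by auto
    then show "finite {card C | C. C \<subseteq> {0..2 * P - 1} \<and> clique C (snd (G_WN ?Z))}"
      by (rule finite_subset) simp
  next
    fix k
    assume "k \<in> {card C | C. C \<subseteq> {0..2 * P - 1} \<and> clique C (snd (G_WN ?Z))}"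
    then show "k \<le> 4"
      using card_ternary_sums_le_4[OF odd P(2)] by (auto simp: clique)
  next
    \<comment> \<open>Both elements \<open>0\<close>, \<open>p\<close> of the class of \<open>0\<close>, and one each from the classes of
      \<open>1\<close> and \<open>-1\<close>.\<close>
    let ?C = "{0, 1, P, 2 * P - 1}"
    have "?C \<subseteq> {0..2 * P - 1}" "card ?C = 4"
      using P(2) by auto
    moreover have "\<forall>x\<in>?C. \<forall>y\<in>?C. x \<noteq> y \<longrightarrow> ternary_residue P (x + y)"
      by (auto simp: ternary_residue_def)
    ultimately show "4 \<in> {card C | C. C \<subseteq> {0..2 * P - 1} \<and> clique C (snd (G_WN ?Z))}"
      using clique[of ?C] by (auto intro!: exI[of _ ?C])
  qed
  then have "clique_number (G_WN ?Z) = 4"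
    by (simp add: clique_number_def res_carrier_eq G_WN_def)
  then show ?thesis
    by (simp add: P_def)
qed

end
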